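(* Let $q$ be an odd prime power and $n\ge 0$ an integer. Fix characters $\omega\colon\mathbb F_q^\times\to\mathbb C^\times$ and $\psi\colon\mathbb F_q\to\mathbb C^\times$ and some $T\in\mathrm{GL}_n(\mathbb F_q)$, and set $$g_n(\omega,\psi,T)=\sum_{A\in\mathrm{GL}_n(\mathbb F_q)}\omega(\det A)\psi(\operatorname{tr}AT).$$ (a) Suppose $\psi\ne1$. Then $$g_n(\omega,\psi,T)=\frac{q^{n(n-1)/2}}{\omega(\det T)}\cdot g(\omega,\psi)^n.$$ (b) Suppose $\psi=1$ and $\omega=1$. Then $$g_n(\omega,\psi,T)=\prod_{i=0}^{n-1}\left(q^n-q^i\right).$$ (c) If $\psi=1$ and $\omega\ne1$, the sum $g_n(\omega,\psi,T)$ vanishes when $n$ is positive.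
   Context: $g(\omega,\psi)=\sum_{a\in\mathbb F_q^\times}\omega(a)\psi(a)$ is the usual Gauss sum. *)

theory Defs
  imports Complex_Main "HOL-Library.Cardinality" "Jordan_Normal_Form.Determinant"
begin

text \<open>
  A finite field is a type of class \<open>{field, finite}\<close>, and q is its cardinality.

  A multiplicative character is represented by a total function on the field. Only its
  restriction to the nonzero elements is meaningful: the value at 0 is unconstrained and is
  never used below.
\<close>

definition mult_character :: "('a::field \<Rightarrow> complex) \<Rightarrow> bool" where
  "mult_character \<omega> \<longleftrightarrow>
     (\<forall>a. a \<noteq> 0 \<longrightarrow> \<omega> a \<noteq> 0) \<and>
     (\<forall>a b. a \<noteq> 0 \<longrightarrow> b \<noteq> 0 \<longrightarrow> \<omega> (a * b) = \<omega> a * \<omega> b)"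

definition trivial_mult_character :: "('a::field \<Rightarrow> complex) \<Rightarrow> bool" where
  "trivial_mult_character \<omega> \<longleftrightarrow> (\<forall>a. a \<noteq> 0 \<longrightarrow> \<omega> a = 1)"

definition add_character :: "('a::field \<Rightarrow> complex) \<Rightarrow> bool" where
  "add_character \<psi> \<longleftrightarrow> (\<forall>a. \<psi> a \<noteq> 0) \<and> (\<forall>a b. \<psi> (a + b) = \<psi> a * \<psi> b)"

definition trivial_add_character :: "('a::field \<Rightarrow> complex) \<Rightarrow> bool" where
  "trivial_add_character \<psi> \<longleftrightarrow> (\<forall>a. \<psi> a = 1)"

definition gauss_sum :: "('a::{field,finite} \<Rightarrow> complex) \<Rightarrow> ('a \<Rightarrow> complex) \<Rightarrow> complex" where
  "gauss_sum \<omega> \<psi> = (\<Sum>a\<in>UNIV - {0}. \<omega> a * \<psi> a)"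

definition mat_trace :: "'a::comm_monoid_add mat \<Rightarrow> 'a" where
  "mat_trace A = (\<Sum>i<dim_row A. A $$ (i, i))"

definition GL :: "nat \<Rightarrow> 'a::field mat set" where
  "GL n = {A \<in> carrier_mat n n. invertible_mat A}"

text \<open>The index set of the following sum is finite because the field is.\<close>

lemma finite_GL: "finite (GL n :: 'a::{field,finite} mat set)"
proof -
  let ?D = "{0..<n} \<times> {0..<n}"
  have "carrier_mat n n \<subseteq> (\<lambda>f. mat n n f) ` (?D \<rightarrow>\<^sub>E (UNIV :: 'a set))"
  proof
    fix A :: "'a mat" assume A: "A \<in> carrier_mat n n"
    have "A = mat n n (restrict (\<lambda>ij. A $$ ij) ?D)"
      using A by (intro eq_matI) auto
    then show "A \<in> (\<lambda>f. mat n n f) ` (?D \<rightarrow>\<^sub>E (UNIV :: 'a set))"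
      by (intro image_eqI[where x = "restrict (\<lambda>ij. A $$ ij) ?D"]) auto
  qed
  moreover have "finite (?D \<rightarrow>\<^sub>E (UNIV :: 'a set))"
    by (intro finite_PiE) auto
  ultimately have "finite (carrier_mat n n :: 'a mat set)"
    by (rule finite_subset[OF _ finite_imageI])
  then show ?thesis
    by (rule rev_finite_subset) (auto simp: GL_def)
qed

definition matrix_gauss_sum ::
    "nat \<Rightarrow> ('a::{field,finite} \<Rightarrow> complex) \<Rightarrow> ('a \<Rightarrow> complex) \<Rightarrow> 'a mat \<Rightarrow> complex" where
  "matrix_gauss_sum n \<omega> \<psi> T = (\<Sum>A\<in>GL n. \<omega> (det A) * \<psi> (mat_trace (A * T)))"

end

theory Submission
  imports Defs "Berlekamp_Zassenhaus.Berlekamp_Type_Based"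
begin

text \<open>
  Replacing \<open>A\<close> by \<open>A * T\<inverse>\<close> pulls out the factor \<open>1 / \<omega> (det T)\<close>, so it suffices to treat
  \<open>T = 1\<close>. Write \<open>G n\<close> for that sum, \<open>g\<close> for \<open>gauss_sum \<omega> \<psi>\<close> and \<open>q\<close> for the size of the field.

  For \<open>\<psi>\<close> nontrivial, the formula follows from the recurrence \<open>G (n + 1) = q ^ n * g * G n\<close>
  (\<open>matrix_gauss_sum_Suc\<close>), which comes from averaging over a group of shears. Right
  multiplication by the matrix with blocks \<open>1, v, 0, 1\<close> permutes the general linear group, keeps
  the determinant, and adds \<open>v \<bullet> c\<close> to the trace, where \<open>c\<close> is the first column of \<open>A\<close> without
  its top entry (\<open>mat_trace_mult_shear\<close>). Averaging over all row vectors \<open>v\<close> therefore weights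
  the term of \<open>A\<close> with the mean of \<open>\<psi> (v \<bullet> c)\<close>, which is 1 for \<open>c = 0\<close> and 0 otherwise
  (\<open>sum_add_character_scalar_prod\<close>). Only the block triangular matrices with blocks \<open>a, r, 0, D\<close>
  survive; on these the summand is \<open>\<omega> a * \<psi> a\<close> times the summand of \<open>D\<close>. Summing over the unit
  \<open>a\<close> gives \<open>g\<close>, over the free row \<open>r\<close> gives \<open>q ^ n\<close>, and over \<open>D\<close> gives \<open>G n\<close>.

  For \<open>\<psi>\<close> and \<open>\<omega>\<close> trivial, the sum is the order of the group. All fibres of the map sending a
  matrix to its first column have the same size because the group acts transitively on nonzero
  vectors, and the fibre over the first basis vector again consists of block triangular matrices
  (\<open>card_GL_Suc\<close>). For \<open>\<psi>\<close> trivial and \<open>\<omega> a \<noteq> 1\<close>, translation by a matrix of determinant \<open>a\<close>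
  multiplies the sum by \<open>\<omega> a\<close>, so the sum is zero.
\<close>

section \<open>The general linear group\<close>

lemma det_nonzero_obtain_inverse:
  fixes A :: "'a::field mat"
  assumes A: "A \<in> carrier_mat n n" and d: "det A \<noteq> 0"
  obtains B where "B \<in> carrier_mat n n" "A * B = 1\<^sub>m n" "B * A = 1\<^sub>m n"
  using det_non_zero_imp_unit[OF A d, of "()"] unfolding Units_def ring_mat_def by auto

lemma in_GL_iff: "A \<in> GL n \<longleftrightarrow> A \<in> carrier_mat n n \<and> det A \<noteq> 0"
proof
  assume "A \<in> GL n"
  then obtain B where A: "A \<in> carrier_mat n n" and AB: "A * B = 1\<^sub>m n" and BA: "B * A = 1\<^sub>m (dim_row B)"
    unfolding GL_def invertible_mat_def inverts_mat_def by auto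
  have B: "B \<in> carrier_mat n n"
    using arg_cong[OF AB, of dim_col] arg_cong[OF BA, of dim_col] A by auto
  from det_mult[OF A B] AB have "det A * det B = 1" by simp
  with A show "A \<in> carrier_mat n n \<and> det A \<noteq> 0" by auto
next
  assume A: "A \<in> carrier_mat n n \<and> det A \<noteq> 0"
  then obtain B where "B \<in> carrier_mat n n" "A * B = 1\<^sub>m n" "B * A = 1\<^sub>m n"
    using det_nonzero_obtain_inverse by blast
  with A show "A \<in> GL n"
    unfolding GL_def invertible_mat_def inverts_mat_def by auto
qed

lemma GL_0: "GL 0 = {1\<^sub>m 0 :: 'a::field mat}"
  by (auto simp: in_GL_iff intro!: eq_matI)

lemma GL_mult: "A \<in> GL n \<Longrightarrow> B \<in> GL n \<Longrightarrow> A * B \<in> GL n"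
  by (auto simp: in_GL_iff det_mult[of _ n])

lemma GL_inverse:
  assumes "A \<in> GL n"
  obtains B where "B \<in> GL n" "A * B = 1\<^sub>m n" "B * A = 1\<^sub>m n"
proof -
  have A: "A \<in> carrier_mat n n" and d: "det A \<noteq> 0" using assms by (auto simp: in_GL_iff)
  from det_nonzero_obtain_inverse[OF A d] obtain B
    where B: "B \<in> carrier_mat n n" and AB: "A * B = 1\<^sub>m n" and BA: "B * A = 1\<^sub>m n" by blast
  from det_mult[OF A B] AB have "det A * det B = 1" by simp
  with B have "B \<in> GL n" by (auto simp: in_GL_iff)
  with AB BA show thesis using that by blast
qed

lemma sum_GL_mult_right:
  assumes "P \<in> GL n"
  shows "(\<Sum>A\<in>GL n. f (A * P)) = (\<Sum>A\<in>GL n. f A)"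
proof -
  from GL_inverse[OF assms] obtain Q
    where Q: "Q \<in> GL n" "P * Q = 1\<^sub>m n" "Q * P = 1\<^sub>m n" .
  have c: "A * P * Q = A" "A * Q * P = A" if "A \<in> GL n" for A
    using that Q assms by (auto simp: in_GL_iff assoc_mult_mat[of _ n n _ n _ n])
  show ?thesis
    by (rule sum.reindex_bij_witness[where i = "\<lambda>A. A * Q" and j = "\<lambda>A. A * P"])
       (use Q assms c in \<open>auto intro: GL_mult\<close>)
qed

lemma bij_betw_GL_mult_left:
  assumes "P \<in> GL n"
  shows "bij_betw (\<lambda>A. P * A) (GL n) (GL n)"
proof -
  from GL_inverse[OF assms] obtain Q
    where Q: "Q \<in> GL n" "P * Q = 1\<^sub>m n" "Q * P = 1\<^sub>m n" .
  have c: "P * (Q * A) = A" "Q * (P * A) = A" if "A \<in> GL n" for A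
    using that Q assms by (auto simp: in_GL_iff assoc_mult_mat[of _ n n _ n _ n, symmetric])
  show ?thesis
    by (rule bij_betw_byWitness[where f' = "\<lambda>A. Q * A"])
       (use Q assms c in \<open>auto intro: GL_mult\<close>)
qed

lemma GL_col_nonzero:
  fixes A :: "'a::field mat"
  assumes A: "A \<in> GL n" and j: "j < n"
  shows "col A j \<noteq> 0\<^sub>v n"
proof
  assume z: "col A j = 0\<^sub>v n"
  obtain Q where Q: "Q \<in> GL n" "Q * A = 1\<^sub>m n" using GL_inverse[OF A] .
  have "(1\<^sub>m n) $$ (j, j) = row Q j \<bullet> col A j"
    using A Q(1) j unfolding Q(2)[symmetric] by (auto simp: in_GL_iff)
  also have "\<dots> = 0"
    unfolding z using Q(1) by (intro scalar_prod_right_zero) (auto simp: in_GL_iff intro: carrier_vecI)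
  finally show False using j by simp
qed

section \<open>Block upper triangular matrices\<close>

text \<open>
  The matrix with blocks \<open>a, r, 0, D\<close>. It serves both for the matrices over which the recursion
  runs and, as \<open>bordered 1 v (1\<^sub>m n)\<close>, for the shears over which the average is taken.
\<close>
definition bordered :: "'a::zero \<Rightarrow> 'a vec \<Rightarrow> 'a mat \<Rightarrow> 'a mat" where
  "bordered a r D = four_block_mat (mat 1 1 (\<lambda>_. a)) (mat 1 (dim_vec r) (\<lambda>(_, j). r $ j))
                      (0\<^sub>m (dim_row D) 1) D"

lemma bordered_carrier [simp]:
  "D \<in> carrier_mat n n \<Longrightarrow> r \<in> carrier_vec n \<Longrightarrow> bordered a r D \<in> carrier_mat (Suc n) (Suc n)"
  by (rule carrier_matI) (simp_all add: bordered_def)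

lemma bordered_index [simp]:
  assumes "D \<in> carrier_mat n n" "r \<in> carrier_vec n"
  shows "bordered a r D $$ (0, 0) = a"
    and "j < n \<Longrightarrow> bordered a r D $$ (0, Suc j) = r $ j"
    and "i < n \<Longrightarrow> bordered a r D $$ (Suc i, 0) = 0"
    and "i < n \<Longrightarrow> j < n \<Longrightarrow> bordered a r D $$ (Suc i, Suc j) = D $$ (i, j)"
  using assms by (auto simp: bordered_def)

lemma det_bordered:
  fixes a :: "'a::idom"
  assumes "D \<in> carrier_mat n n" "r \<in> carrier_vec n"
  shows "det (bordered a r D) = a * det D"
proof -
  have "det (bordered a r D) = det (mat 1 1 (\<lambda>_. a)) * det D"
    unfolding bordered_def
    by (rule det_four_block_mat_lower_left_zero[where n = 1 and m = n]) (use assms in auto)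
  also have "det (mat 1 1 (\<lambda>_. a)) = a" by (subst det_single) auto
  finally show ?thesis .
qed

lemma mat_trace_bordered:
  assumes "D \<in> carrier_mat n n" "r \<in> carrier_vec n"
  shows "mat_trace (bordered a r D) = a + mat_trace D"
proof -
  have "dim_row (bordered a r D) = Suc n" "dim_row D = n"
    using carrier_matD(1)[OF bordered_carrier[OF assms, of a]] assms by auto
  then show ?thesis using assms
    unfolding mat_trace_def by (simp add: sum.lessThan_Suc_shift del: sum.lessThan_Suc)
qed

text \<open>
  The corner entry ranges over a set \<open>S\<close> because two cases are needed: all units for the Gauss
  sum recurrence, and \<open>S = {1}\<close> for the stabiliser of the first basis vector.
\<close>
lemma bij_betw_bordered:
  fixes S :: "'a::field set"
  assumes "0 \<notin> S"
  shows "bij_betw (\<lambda>(a, r, D). bordered a r D) (S \<times> carrier_vec n \<times> GL n)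
           {A \<in> GL (Suc n). A $$ (0, 0) \<in> S \<and> (\<forall>i<n. A $$ (Suc i, 0) = 0)}"
proof -
  let ?f = "\<lambda>(a, r, D). bordered a r D"
  let ?X = "S \<times> carrier_vec n \<times> GL n"
  let ?Y = "{A \<in> GL (Suc n). A $$ (0, 0) \<in> S \<and> (\<forall>i<n. A $$ (Suc i, 0) = 0)}"
  let ?r = "\<lambda>A :: 'a mat. vec n (\<lambda>j. A $$ (0, Suc j))"
  let ?D = "\<lambda>A :: 'a mat. mat n n (\<lambda>(i, j). A $$ (Suc i, Suc j))"
  let ?g = "\<lambda>A. (A $$ (0, 0), ?r A, ?D A)"
  have fX: "?f x \<in> ?Y" if "x \<in> ?X" for x
    using that assms by (auto simp: in_GL_iff det_bordered)
  have gf: "?g (?f x) = x" if "x \<in> ?X" for x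
    using that by (auto simp: in_GL_iff intro!: eq_vecI eq_matI)
  have fg: "?f (?g A) = A" if "A \<in> ?Y" for A
  proof -
    from that have A: "A \<in> carrier_mat (Suc n) (Suc n)" by (auto simp: in_GL_iff)
    have C: "bordered (A $$ (0, 0)) (?r A) (?D A) \<in> carrier_mat (Suc n) (Suc n)" by simp
    have "bordered (A $$ (0, 0)) (?r A) (?D A) = A"
    proof (rule eq_matI)
      fix i j assume "i < dim_row A" "j < dim_col A"
      then show "bordered (A $$ (0, 0)) (?r A) (?D A) $$ (i, j) = A $$ (i, j)"
        using A that by (cases i; cases j) (auto simp: bordered_index[of _ n])
    qed (use A carrier_matD[OF C] in auto)
    then show ?thesis by simp
  qed
  have gY: "?g A \<in> ?X" if "A \<in> ?Y" for A
  proof -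
    have "det A = A $$ (0, 0) * det (?D A)"
      using fg[OF that] det_bordered[of "?D A" n "?r A" "A $$ (0, 0)"] by auto
    with that show ?thesis by (auto simp: in_GL_iff)
  qed
  show ?thesis
    by (rule bij_betw_byWitness[where f' = ?g]) (use fX gf fg gY in blast)+
qed

text \<open>
  The shear adds \<open>v $ j\<close> times column 0 to column \<open>j + 1\<close>, so the diagonal entry in row \<open>j + 1\<close>
  changes by \<open>v $ j * A $$ (Suc j, 0)\<close>.
\<close>
lemma mat_trace_mult_shear:
  fixes A :: "'a::comm_ring_1 mat"
  assumes A: "A \<in> carrier_mat (Suc n) (Suc n)" and v: "v \<in> carrier_vec n"
  shows "mat_trace (A * bordered 1 v (1\<^sub>m n)) = mat_trace A + v \<bullet> vec n (\<lambda>i. A $$ (Suc i, 0))"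
proof -
  let ?U = "bordered 1 v (1\<^sub>m n)"
  have U: "?U \<in> carrier_mat (Suc n) (Suc n)" using v by simp
  have entry: "(A * ?U) $$ (i, i) = (\<Sum>k<Suc n. A $$ (i, k) * ?U $$ (k, i))" if "i < Suc n" for i
    using that A U by (auto simp: scalar_prod_def lessThan_atLeast0)
  have zero: "(A * ?U) $$ (0, 0) = A $$ (0, 0)"
    using v by (simp add: entry sum.lessThan_Suc_shift bordered_index[of _ n] del: sum.lessThan_Suc)
  have suc: "(A * ?U) $$ (Suc i, Suc i) = v $ i * A $$ (Suc i, 0) + A $$ (Suc i, Suc i)"
    if "i < n" for i
  proof -
    have "(\<Sum>k<n. A $$ (Suc i, Suc k) * ?U $$ (Suc k, Suc i))
        = (\<Sum>k<n. if k = i then A $$ (Suc i, Suc k) else 0)"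
      using v that by (intro sum.cong) (auto simp: bordered_index[of _ n])
    then show ?thesis
      using v that by (simp add: entry sum.lessThan_Suc_shift bordered_index[of _ n] del: sum.lessThan_Suc)
  qed
  have "mat_trace (A * ?U) = (\<Sum>i<Suc n. (A * ?U) $$ (i, i))" using A by (simp add: mat_trace_def)
  also have "\<dots> = A $$ (0, 0) + (\<Sum>i<n. v $ i * A $$ (Suc i, 0) + A $$ (Suc i, Suc i))"
    unfolding sum.lessThan_Suc_shift by (simp add: zero suc)
  also have "\<dots> = mat_trace A + (\<Sum>i<n. v $ i * A $$ (Suc i, 0))"
    using A by (simp add: mat_trace_def sum.lessThan_Suc_shift sum.distrib del: sum.lessThan_Suc)
  finally show ?thesis by (simp add: scalar_prod_def lessThan_atLeast0)
qed

section \<open>Character sums over vectors\<close>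

lemma add_character_zero:
  assumes "add_character \<psi>" shows "\<psi> 0 = 1"
proof -
  have "\<psi> 0 * \<psi> 0 = \<psi> 0" "\<psi> 0 \<noteq> 0"
    using assms unfolding add_character_def by (metis add.right_neutral, blast)
  then show ?thesis by simp
qed

lemma mult_character_one:
  assumes "mult_character \<omega>" shows "\<omega> 1 = 1"
proof -
  have "\<omega> 1 * \<omega> 1 = \<omega> 1" "\<omega> 1 \<noteq> 0"
    using assms unfolding mult_character_def by (metis mult.right_neutral zero_neq_one)+
  then show ?thesis by simp
qed

text \<open>
  Orthogonality of characters of the vector group: if \<open>c \<noteq> 0\<close>, some \<open>w\<close> has \<open>\<psi> (w \<bullet> c) \<noteq> 1\<close>, and
  translation by \<open>w\<close> multiplies the sum by this value.
\<close>
lemma sum_add_character_scalar_prod: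
  fixes \<psi> :: "'a::{field,finite} \<Rightarrow> complex"
  assumes add: "add_character \<psi>" and nontriv: "\<not> trivial_add_character \<psi>"
    and c: "c \<in> carrier_vec n"
  shows "(\<Sum>v\<in>carrier_vec n. \<psi> (v \<bullet> c)) = (if c = 0\<^sub>v n then of_nat CARD('a) ^ n else 0)"
proof (cases "c = 0\<^sub>v n")
  case True
  have "(\<Sum>v\<in>carrier_vec n. \<psi> (v \<bullet> c)) = (\<Sum>v\<in>(carrier_vec n :: 'a vec set). 1)"
    using True add_character_zero[OF add] by (intro sum.cong) auto
  then show ?thesis using True by (simp add: card_carrier_vec)
next
  case False
  then obtain j where j: "j < n" "c $ j \<noteq> 0" using c by (metis eq_vecI carrier_vecD index_zero_vec)
  from nontriv obtain x where x: "\<psi> x \<noteq> 1" by (auto simp: trivial_add_character_def)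
  define w where "w = (x / c $ j) \<cdot>\<^sub>v unit_vec n j"
  have w: "w \<in> carrier_vec n" by (simp add: w_def)
  have wc: "w \<bullet> c = x" using j c by (simp add: w_def)
  have cancel: "v + w - w = v" "v - w + w = v" if "v \<in> carrier_vec n" for v
    using that w by (auto intro!: eq_vecI)
  let ?S = "\<Sum>v\<in>carrier_vec n. \<psi> (v \<bullet> c)"
  have "?S = (\<Sum>v\<in>carrier_vec n. \<psi> ((v + w) \<bullet> c))"
    by (rule sum.reindex_bij_witness[where i = "\<lambda>v. v + w" and j = "\<lambda>v. v - w"])
       (use w cancel in auto)
  also have "\<dots> = (\<Sum>v\<in>carrier_vec n. \<psi> (v \<bullet> c) * \<psi> x)"
    using add w c wc
    by (intro sum.cong) (auto simp: add_scalar_prod_distrib[of _ n] add_character_def)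
  also have "\<dots> = ?S * \<psi> x" by (simp add: sum_distrib_right)
  finally have "?S * (1 - \<psi> x) = 0" by (simp add: algebra_simps)
  with x False show ?thesis by simp
qed

section \<open>Matrix Gauss sums\<close>

lemma matrix_gauss_sum_eq_one_mat:
  fixes \<omega> \<psi> :: "'a::{field,finite} \<Rightarrow> complex"
  assumes mult: "mult_character \<omega>" and T: "T \<in> GL n"
  shows "matrix_gauss_sum n \<omega> \<psi> T = matrix_gauss_sum n \<omega> \<psi> (1\<^sub>m n) / \<omega> (det T)"
proof -
  have "\<omega> (det (A * T)) = \<omega> (det A) * \<omega> (det T)" "\<omega> (det T) \<noteq> 0" if "A \<in> GL n" for A
    using that T mult by (auto simp: in_GL_iff det_mult[of _ n] mult_character_def)
  then have "matrix_gauss_sum n \<omega> \<psi> T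
      = (\<Sum>A\<in>GL n. \<omega> (det (A * T)) / \<omega> (det T) * \<psi> (mat_trace (A * T)))"
    unfolding matrix_gauss_sum_def by (intro sum.cong) auto
  also have "\<dots> = (\<Sum>A\<in>GL n. \<omega> (det A) / \<omega> (det T) * \<psi> (mat_trace A))"
    by (rule sum_GL_mult_right[OF T])
  also have "\<dots> = (\<Sum>A\<in>GL n. \<omega> (det A) * \<psi> (mat_trace A)) / \<omega> (det T)"
    by (simp add: sum_divide_distrib)
  also have "(\<Sum>A\<in>GL n. \<omega> (det A) * \<psi> (mat_trace A)) = matrix_gauss_sum n \<omega> \<psi> (1\<^sub>m n)"
    unfolding matrix_gauss_sum_def by (intro sum.cong) (auto simp: in_GL_iff)
  finally show ?thesis .
qed

text \<open>
  The set \<open>B\<close> in the proof consists of the matrices left over after averaging over the shears.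
\<close>
lemma matrix_gauss_sum_Suc:
  fixes \<omega> \<psi> :: "'a::{field,finite} \<Rightarrow> complex"
  assumes mult: "mult_character \<omega>" and add: "add_character \<psi>"
    and nontriv: "\<not> trivial_add_character \<psi>"
  shows "matrix_gauss_sum (Suc n) \<omega> \<psi> (1\<^sub>m (Suc n))
       = of_nat CARD('a) ^ n * gauss_sum \<omega> \<psi> * matrix_gauss_sum n \<omega> \<psi> (1\<^sub>m n)"
proof -
  define q where "q = (of_nat CARD('a) :: complex)"
  have q: "q \<noteq> 0" by (simp add: q_def)
  define F where "F = (\<lambda>A. \<omega> (det A) * \<psi> (mat_trace A))"
  define V where "V = (carrier_vec n :: 'a vec set)"
  define below where "below = (\<lambda>A :: 'a mat. vec n (\<lambda>i. A $$ (Suc i, 0)))"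
  define B where "B = {A \<in> GL (Suc n). A $$ (0, 0) \<in> UNIV - {0} \<and> (\<forall>i<n. A $$ (Suc i, 0) = (0::'a))}"
  have G: "matrix_gauss_sum m \<omega> \<psi> (1\<^sub>m m) = (\<Sum>A\<in>GL m. F A)" for m
    unfolding matrix_gauss_sum_def F_def by (intro sum.cong) (auto simp: in_GL_iff)
  have cardV: "of_nat (card V) = q ^ n" by (simp add: V_def q_def card_carrier_vec)
  have shear: "F (A * bordered 1 v (1\<^sub>m n)) = F A * \<psi> (v \<bullet> below A)"
    if "A \<in> GL (Suc n)" "v \<in> V" for A v
    using that add
    by (auto simp: F_def V_def below_def in_GL_iff mat_trace_mult_shear det_mult[of _ "Suc n"]
          det_bordered[of _ n] add_character_def)
  have zero_iff: "below A = 0\<^sub>v n \<longleftrightarrow> A \<in> B" if A: "A \<in> GL (Suc n)" for A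
  proof -
    have "A $$ (0, 0) \<noteq> 0" if z: "\<forall>i<n. A $$ (Suc i, 0) = 0"
    proof
      assume "A $$ (0, 0) = 0"
      with z have "col A 0 = 0\<^sub>v (Suc n)"
        using A by (intro eq_vecI) (auto simp: in_GL_iff less_Suc_eq_0_disj)
      with GL_col_nonzero[OF A, of 0] show False by simp
    qed
    moreover have "below A = 0\<^sub>v n \<longleftrightarrow> (\<forall>i<n. A $$ (Suc i, 0) = 0)"
      unfolding below_def by (auto simp: vec_eq_iff)
    ultimately show ?thesis using A by (auto simp: B_def)
  qed
  have "q ^ n * (\<Sum>A\<in>GL (Suc n). F A) = (\<Sum>v\<in>V. \<Sum>A\<in>GL (Suc n). F A)"
    by (simp add: cardV)
  also have "\<dots> = (\<Sum>v\<in>V. \<Sum>A\<in>GL (Suc n). F (A * bordered 1 v (1\<^sub>m n)))"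
    by (intro sum.cong refl sum_GL_mult_right[symmetric]) (auto simp: V_def in_GL_iff det_bordered[of _ n])
  also have "\<dots> = (\<Sum>v\<in>V. \<Sum>A\<in>GL (Suc n). F A * \<psi> (v \<bullet> below A))"
    by (intro sum.cong) (auto simp: shear)
  also have "\<dots> = (\<Sum>A\<in>GL (Suc n). \<Sum>v\<in>V. F A * \<psi> (v \<bullet> below A))" by (rule sum.swap)
  also have "\<dots> = (\<Sum>A\<in>GL (Suc n). F A * (if below A = 0\<^sub>v n then q ^ n else 0))"
    unfolding V_def q_def below_def
    by (simp add: sum_distrib_left[symmetric] sum_add_character_scalar_prod[OF add nontriv])
  also have "\<dots> = (\<Sum>A\<in>GL (Suc n). if A \<in> B then q ^ n * F A else 0)"
    by (intro sum.cong) (auto simp: zero_iff)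
  also have "\<dots> = (\<Sum>A\<in>B. q ^ n * F A)"
    by (subst sum.inter_restrict[symmetric]) (auto simp: finite_GL B_def intro!: sum.cong)
  also have "\<dots> = q ^ n * (\<Sum>A\<in>B. F A)" by (simp add: sum_distrib_left)
  finally have "(\<Sum>A\<in>GL (Suc n). F A) = (\<Sum>A\<in>B. F A)" using q by simp
  also have "\<dots> = (\<Sum>x\<in>(UNIV - {0}) \<times> V \<times> GL n. F (case x of (a, r, D) \<Rightarrow> bordered a r D))"
    unfolding B_def V_def by (rule sum.reindex_bij_betw[OF bij_betw_bordered, symmetric]) simp
  also have "\<dots> = (\<Sum>(a, r, D)\<in>(UNIV - {0}) \<times> V \<times> GL n. (\<omega> a * \<psi> a) * F D)"
    using mult add
    by (intro sum.cong) (auto simp: F_def V_def in_GL_iff det_bordered[of _ n]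
          mat_trace_bordered[of _ n] mult_character_def add_character_def)
  also have "\<dots> = (\<Sum>a\<in>UNIV - {0}. \<Sum>r\<in>V. \<Sum>D\<in>GL n. (\<omega> a * \<psi> a) * F D)"
    by (simp only: sum.cartesian_product)
  also have "\<dots> = (\<Sum>a\<in>UNIV - {0}. (\<omega> a * \<psi> a) * (q ^ n * (\<Sum>D\<in>GL n. F D)))"
    by (intro sum.cong refl) (simp add: sum_distrib_left[symmetric] cardV)
  also have "\<dots> = gauss_sum \<omega> \<psi> * (q ^ n * (\<Sum>D\<in>GL n. F D))"
    by (simp only: gauss_sum_def sum_distrib_right)
  finally show ?thesis by (simp add: G q_def mult_ac)
qed

lemma matrix_gauss_sum_one_mat:
  fixes \<omega> \<psi> :: "'a::{field,finite} \<Rightarrow> complex"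
  assumes mult: "mult_character \<omega>" and add: "add_character \<psi>"
    and nontriv: "\<not> trivial_add_character \<psi>"
  shows "matrix_gauss_sum n \<omega> \<psi> (1\<^sub>m n) = of_nat CARD('a) ^ (n * (n - 1) div 2) * gauss_sum \<omega> \<psi> ^ n"
proof (induction n)
  case 0
  show ?case
    by (simp add: matrix_gauss_sum_def GL_0 mult_character_one[OF mult] add_character_zero[OF add]
          mat_trace_def)
next
  case (Suc n)
  have "Suc n * (Suc n - 1) div 2 = n + n * (n - 1) div 2"
  proof -
    have "Suc n * (Suc n - 1) = n * (n - 1) + n * 2" by (cases n) (auto simp: algebra_simps)
    then show ?thesis by simp
  qed
  then show ?case by (simp add: matrix_gauss_sum_Suc[OF assms] Suc.IH power_add)
qed

lemma sum_mult_character_det_eq_0: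
  fixes \<omega> :: "'a::{field,finite} \<Rightarrow> complex"
  assumes mult: "mult_character \<omega>" and nontriv: "\<not> trivial_mult_character \<omega>" and n: "n > 0"
  shows "(\<Sum>A\<in>GL n. \<omega> (det A)) = 0"
proof -
  from nontriv obtain a where a: "a \<noteq> 0" "\<omega> a \<noteq> 1" by (auto simp: trivial_mult_character_def)
  let ?P = "multrow_mat n 0 a"
  have P: "?P \<in> GL n" "det ?P = a" using a n by (auto simp: in_GL_iff det_multrow_mat)
  let ?S = "\<Sum>A\<in>GL n. \<omega> (det A)"
  have "?S = (\<Sum>A\<in>GL n. \<omega> (det (A * ?P)))" by (rule sum_GL_mult_right[OF P(1), symmetric])
  also have "\<dots> = (\<Sum>A\<in>GL n. \<omega> (det A) * \<omega> a)"
    using P a mult by (intro sum.cong) (auto simp: in_GL_iff det_mult[of _ n] mult_character_def)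
  also have "\<dots> = ?S * \<omega> a" by (simp add: sum_distrib_right)
  finally have "?S * (1 - \<omega> a) = 0" by (simp add: algebra_simps)
  with a show ?thesis by simp
qed

section \<open>The order of the general linear group\<close>

text \<open>
  Transitivity on nonzero vectors. If the top entry of \<open>u\<close> is nonzero, replacing the first column
  of the identity by \<open>u\<close> gives a lower triangular matrix. Otherwise a nonzero entry of \<open>u\<close> is
  first added to the top one, and a row operation on the resulting matrix undoes this.
\<close>
lemma exists_GL_with_first_col:
  fixes u :: "'a::field vec"
  assumes u: "u \<in> carrier_vec (Suc n)" and nz: "u \<noteq> 0\<^sub>v (Suc n)"
  shows "\<exists>P\<in>GL (Suc n). col P 0 = u"
proof -
  have lead: "\<exists>P\<in>GL (Suc n). col P 0 = w"
    if w: "w \<in> carrier_vec (Suc n)" and w0: "w $ 0 \<noteq> 0" for w :: "'a vec"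
  proof -
    let ?P = "mat (Suc n) (Suc n) (\<lambda>(i, j). if j = 0 then w $ i else if i = j then 1 else 0)"
    have "det ?P = prod_list (diag_mat ?P)"
      by (rule det_lower_triangular[of "Suc n"]) auto
    also have "\<dots> \<noteq> 0" using w0 by (auto simp: prod_list_zero_iff diag_mat_def)
    finally have "?P \<in> GL (Suc n)" by (simp add: in_GL_iff)
    moreover have "col ?P 0 = w" using w by (intro eq_vecI) auto
    ultimately show ?thesis by blast
  qed
  show ?thesis
  proof (cases "u $ 0 = 0")
    case False
    then show ?thesis using lead u by blast
  next
    case True
    from nz u obtain j where j: "j < Suc n" "u $ j \<noteq> 0"
      by (metis eq_vecI carrier_vecD index_zero_vec)
    with True have j0: "j \<noteq> 0" by metis
    let ?w = "vec (Suc n) (\<lambda>i. if i = 0 then u $ j else u $ i)"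
    obtain P where P: "P \<in> GL (Suc n)" "col P 0 = ?w" using lead[of ?w] j by auto
    have P': "P \<in> carrier_mat (Suc n) (Suc n)" "det P \<noteq> 0" using P by (auto simp: in_GL_iff)
    have entry: "P $$ (i, 0) = ?w $ i" if "i < Suc n" for i
      using arg_cong[OF P(2), of "\<lambda>x. x $ i"] that P' by auto
    let ?R = "addrow (- 1) 0 j P"
    have "?R \<in> GL (Suc n)"
      using P' j j0 det_addrow[of j "Suc n" 0 P "- 1"] by (auto simp: in_GL_iff)
    moreover have "col ?R 0 = u"
      using P' u j j0 True by (intro eq_vecI) (auto simp: entry)
    ultimately show ?thesis by blast
  qed
qed

text \<open>
  Orbit counting for the action on nonzero vectors: the first column takes \<open>q ^ (n + 1) - 1\<close>
  values, and every fibre has as many elements as the fibre over the first basis vector, which is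
  parametrised by a free row and a smaller invertible matrix.
\<close>
lemma card_GL_Suc:
  "card (GL (Suc n) :: 'a::{field,finite} mat set)
     = (CARD('a) ^ Suc n - 1) * (CARD('a) ^ n * card (GL n :: 'a mat set))"
proof -
  let ?G = "GL (Suc n) :: 'a mat set"
  let ?e = "unit_vec (Suc n) 0 :: 'a vec"
  define F where "F = (\<lambda>u. {A \<in> ?G. col A 0 = u})"
  have fibre: "card (F u) = card (F ?e)" if u: "u \<in> carrier_vec (Suc n) - {0\<^sub>v (Suc n)}" for u
  proof -
    from u exists_GL_with_first_col obtain P where P: "P \<in> ?G" "col P 0 = u" by blast
    have colP: "col (P * A) 0 = P *\<^sub>v col A 0" if "A \<in> ?G" for A
      using that P by (auto simp: in_GL_iff intro!: eq_vecI)
    have Pe: "P *\<^sub>v ?e = u" using P by (auto simp: in_GL_iff intro!: eq_vecI)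
    obtain Q where Q: "Q \<in> ?G" "Q * P = 1\<^sub>m (Suc n)" using GL_inverse[OF P(1)] .
    have inj: "x = ?e" if "P *\<^sub>v x = u" "x \<in> carrier_vec (Suc n)" for x
    proof -
      have "Q *\<^sub>v (P *\<^sub>v y) = y" if "y \<in> carrier_vec (Suc n)" for y
        using that P Q by (auto simp: in_GL_iff assoc_mult_mat_vec[of _ "Suc n" "Suc n" _ "Suc n", symmetric])
      with that Pe show ?thesis by (metis unit_vec_carrier)
    qed
    have *: "col A 0 = ?e \<longleftrightarrow> col (P * A) 0 = u" if "A \<in> ?G" for A
    proof -
      have "col A 0 \<in> carrier_vec (Suc n)"
        using that by (auto simp: in_GL_iff intro: carrier_vecI)
      then show ?thesis unfolding colP[OF that] using Pe inj[of "col A 0"] by metis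
    qed
    have "bij_betw (\<lambda>A. P * A) (F ?e) (F u)"
      unfolding F_def by (rule bij_betw_Collect[OF bij_betw_GL_mult_left[OF P(1)]]) (simp add: *)
    then show ?thesis using bij_betw_same_card by metis
  qed
  have e_iff: "col A 0 = ?e \<longleftrightarrow> A $$ (0, 0) \<in> {1} \<and> (\<forall>i<n. A $$ (Suc i, 0) = 0)"
    if "A \<in> ?G" for A
    using that by (auto simp: in_GL_iff vec_eq_iff less_Suc_eq_0_disj)
  have "card (F ?e) = card ({1 :: 'a} \<times> (carrier_vec n :: 'a vec set) \<times> (GL n :: 'a mat set))"
  proof -
    have "F ?e = {A \<in> ?G. A $$ (0, 0) \<in> {1} \<and> (\<forall>i<n. A $$ (Suc i, 0) = 0)}"
      unfolding F_def using e_iff by blast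
    then show ?thesis using bij_betw_same_card[OF bij_betw_bordered[of "{1 :: 'a}" n]] by simp
  qed
  then have card_e: "card (F ?e) = CARD('a) ^ n * card (GL n :: 'a mat set)"
    by (simp add: card_cartesian_product card_carrier_vec)
  let ?N = "carrier_vec (Suc n) - {0\<^sub>v (Suc n)} :: 'a vec set"
  have "col A 0 \<in> ?N" if "A \<in> ?G" for A
    using that GL_col_nonzero[OF that, of 0] by (auto simp: in_GL_iff intro: carrier_vecI)
  then have "?G = (\<Union>u\<in>?N. F u)" unfolding F_def by blast
  then have "card ?G = (\<Sum>u\<in>?N. card (F u))"
    by (subst card_UN_disjoint[symmetric]) (auto simp: F_def finite_GL)
  also have "\<dots> = (\<Sum>u\<in>?N. card (F ?e))" by (intro sum.cong refl fibre)
  also have "\<dots> = card ?N * card (F ?e)" by simp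
  also have "card ?N = CARD('a) ^ Suc n - 1" by (simp add: card_carrier_vec card_Diff_singleton)
  finally show ?thesis by (simp add: card_e)
qed

lemma card_GL:
  "of_nat (card (GL n :: 'a::{field,finite} mat set))
     = (\<Prod>i<n. of_nat CARD('a) ^ n - of_nat CARD('a) ^ i :: complex)"
proof (induction n)
  case 0
  then show ?case by (simp add: GL_0)
next
  case (Suc n)
  define q where "q = (of_nat CARD('a) :: complex)"
  have "(\<Prod>i<Suc n. q ^ Suc n - q ^ i) = (q ^ Suc n - 1) * (\<Prod>i<n. q ^ Suc n - q ^ Suc i)"
    by (subst prod.lessThan_Suc_shift) simp
  also have "(\<Prod>i<n. q ^ Suc n - q ^ Suc i) = (\<Prod>i<n. q * (q ^ n - q ^ i))"
    by (simp add: algebra_simps)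
  also have "\<dots> = q ^ n * (\<Prod>i<n. q ^ n - q ^ i)" by (simp add: prod.distrib)
  finally show ?case
    by (simp add: card_GL_Suc Suc.IH q_def of_nat_diff del: power_Suc prod.lessThan_Suc)
qed

section \<open>Evaluation of the matrix Gauss sums\<close>

theorem theorem3p2p4:
  fixes q n :: nat
    and \<omega> \<psi> :: "'a::{field,finite} \<Rightarrow> complex"
    and T :: "'a mat"
  assumes "CARD('a) = q" and "odd q"
    and "mult_character \<omega>" and "add_character \<psi>"
    and "T \<in> GL n"
  shows "(\<not> trivial_add_character \<psi> \<longrightarrow>
           matrix_gauss_sum n \<omega> \<psi> T =
             of_nat q ^ (n * (n - 1) div 2) / \<omega> (det T) * gauss_sum \<omega> \<psi> ^ n) \<and>
         (trivial_add_character \<psi> \<and> trivial_mult_character \<omega> \<longrightarrow>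
           matrix_gauss_sum n \<omega> \<psi> T = (\<Prod>i<n. (of_nat q ^ n - of_nat q ^ i))) \<and>
         (trivial_add_character \<psi> \<and> \<not> trivial_mult_character \<omega> \<and> n > 0 \<longrightarrow>
           matrix_gauss_sum n \<omega> \<psi> T = 0)"
proof (intro conjI impI)
  assume "\<not> trivial_add_character \<psi>"
  then show "matrix_gauss_sum n \<omega> \<psi> T =
      of_nat q ^ (n * (n - 1) div 2) / \<omega> (det T) * gauss_sum \<omega> \<psi> ^ n"
    using assms matrix_gauss_sum_eq_one_mat[of \<omega> T n \<psi>] matrix_gauss_sum_one_mat[of \<omega> \<psi> n] by simp
next
  assume "trivial_add_character \<psi> \<and> trivial_mult_character \<omega>"
  then have "matrix_gauss_sum n \<omega> \<psi> T = (\<Sum>A\<in>(GL n :: 'a mat set). 1)"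
    unfolding matrix_gauss_sum_def trivial_add_character_def trivial_mult_character_def
    by (intro sum.cong) (auto simp: in_GL_iff)
  then show "matrix_gauss_sum n \<omega> \<psi> T = (\<Prod>i<n. (of_nat q ^ n - of_nat q ^ i))"
    using card_GL[of n, where 'a = 'a] assms(1) by simp
next
  assume "trivial_add_character \<psi> \<and> \<not> trivial_mult_character \<omega> \<and> n > 0"
  then show "matrix_gauss_sum n \<omega> \<psi> T = 0"
    using sum_mult_character_det_eq_0[OF assms(3)]
    by (simp add: matrix_gauss_sum_def trivial_add_character_def)
qed

end
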